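(* For every integer $d\ge 2$ there exists a constant $C_d>0$, depending only on $d$, such that for every monic polynomial $p$ of degree $d$ with all roots real, with finite free cumulants $\kappa_1(p)=0$ and $\kappa_2(p)=1$, and for every integer $n>0$, $$L\left(D_{1/\sqrt{n}}(p^{\boxplus_d n}),\, D_{1/\sqrt{d}}(H_d)\right)< \frac{C_d}{\sqrt{n}}.$$
   Context: Finite free additive convolution: for monic polynomials $p(x)=\sum_{i=0}^d x^{d-i}(-1)^i a_i^p$ and $q(x)=\sum_{i=0}^d x^{d-i}(-1)^i a_i^q$ of degree $d$, $$(p\boxplus_d q)(x)=\sum_{r=0}^d x^{d-r}(-1)^r\sum_{i+j=r}\frac{(d-i)!\,(d-j)!}{d!\,(d-i-j)!}\,a_i^p a_j^q .$$ $p^{\boxplus_d n}=p\boxplus_d\cdots\boxplus_d p$ ($n$ copies). This operation preserves the class of monic degree-$d$ polynomials with all roots real (known fact). Dilation: for $\lambda>0$ and $p$ of degree $d$, $D_\lambda p(x)=\lambda^d p(x/\lambda)$. Hermite polynomial: $H_d(x)=d!\sum_{i=0}^{\lfloor d/2\rfloor}\frac{(-1)^i}{i!\,(d-2i)!}\frac{x^{d-2i}}{2^i}$ (its roots are all real). Moments and cumulants: if $p$ has roots $\lambda_1,\dots,\lambda_d$ (with multiplicity), $m_k(p)=\frac1d\sum_{i=1}^d\lambda_i^k$. The first two finite free cumulants are $\kappa_1(p)=m_1(p)$ and $\kappa_2(p)=\frac{d}{d-1}\left(m_2(p)-m_1(p)^2\right)$. Distance: for a degree-$d$ polynomial $p$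 with real roots $\lambda_1,\dots,\lambda_d$, $\mu_p=\frac1d\sum_{i=1}^d\delta_{\lambda_i}$. For two such polynomials, $L(p,q)=d_L(\mu_p,\mu_q)$, where $d_L$ is the Lévy distance $$d_L(\mu,\nu)=\inf\{\epsilon>0 \mid F(x-\epsilon)-\epsilon\le G(x)\le F(x+\epsilon)+\epsilon\ \text{ for all } x\in\mathbb{R}\},$$ with $F,G$ the cumulative distribution functions of $\mu,\nu$ respectively. *)

theory Defs
  imports "HOL-Probability.Probability" "HOL-Computational_Algebra.Computational_Algebra"
begin

text \<open>Polynomials have real coefficients, which is automatic for a monic polynomial all of whose
  complex roots are real.\<close>

definition real_rooted :: "real poly \<Rightarrow> bool" where
  "real_rooted p \<longleftrightarrow> (\<forall>z. poly (map_poly complex_of_real p) z = 0 \<longrightarrow> z \<in> \<real>)"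

text \<open>The number \<open>a\<^sub>i\<close> in \<open>p(x) = (\<Sum>i\<le>d. x^(d - i) * (-1)^i * a\<^sub>i)\<close>.\<close>

definition signed_coeff :: "nat \<Rightarrow> real poly \<Rightarrow> nat \<Rightarrow> real" where
  "signed_coeff d p i = (-1) ^ i * coeff p (d - i)"

definition finite_free_conv :: "nat \<Rightarrow> real poly \<Rightarrow> real poly \<Rightarrow> real poly" where
  "finite_free_conv d p q =
     (\<Sum>r\<le>d. monom ((-1) ^ r *
        (\<Sum>(i, j)\<in>{(i, j). i + j = r}.
           fact (d - i) * fact (d - j) / (fact d * fact (d - i - j))
             * signed_coeff d p i * signed_coeff d q j)) (d - r))"

text \<open>The convolution of \<open>n\<close> copies of \<open>p\<close>, meant for \<open>n \<ge> 1\<close>.\<close>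

definition finite_free_power :: "nat \<Rightarrow> real poly \<Rightarrow> nat \<Rightarrow> real poly" where
  "finite_free_power d p n = (finite_free_conv d p ^^ (n - 1)) p"

definition dilation :: "real \<Rightarrow> real poly \<Rightarrow> real poly" where
  "dilation c p = smult (c ^ degree p) (pcompose p [:0, 1 / c:])"

definition hermite_poly :: "nat \<Rightarrow> real poly" where
  "hermite_poly d = smult (fact d)
     (\<Sum>i\<le>d div 2. monom ((-1) ^ i / (fact i * fact (d - 2 * i)) * (1 / 2 ^ i)) (d - 2 * i))"

definition moment :: "nat \<Rightarrow> real poly \<Rightarrow> real" where
  "moment k p = 1 / real (degree p) * (\<Sum>x\<in>#proots p. x ^ k)"

definition finite_free_cumulant1 :: "real poly \<Rightarrow> real" where
  "finite_free_cumulant1 p = moment 1 p"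

definition finite_free_cumulant2 :: "real poly \<Rightarrow> real" where
  "finite_free_cumulant2 p =
     real (degree p) / (real (degree p) - 1) * (moment 2 p - (moment 1 p)\<^sup>2)"

text \<open>The measure \<open>1/d * (\<Sum>i. \<delta>(\<lambda>\<^sub>i))\<close>, with \<open>\<lambda>\<^sub>i\<close> the roots counted with multiplicity. For a
  real-rooted \<open>p\<close> of degree \<open>d \<ge> 1\<close> the multiset \<open>proots p\<close> has size \<open>d\<close>. The \<open>distr\<close> only
  replaces the discrete sigma-algebra of the pmf by the Borel one.\<close>

definition root_measure :: "real poly \<Rightarrow> real measure" where
  "root_measure p = distr (measure_pmf (pmf_of_multiset (proots p))) borel (\<lambda>x. x)"

definition levy_dist :: "real measure \<Rightarrow> real measure \<Rightarrow> real" where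
  "levy_dist M N = Inf {\<epsilon>. \<epsilon> > 0 \<and>
     (\<forall>x. cdf M (x - \<epsilon>) - \<epsilon> \<le> cdf N x \<and> cdf N x \<le> cdf M (x + \<epsilon>) + \<epsilon>)}"

definition poly_levy_dist :: "real poly \<Rightarrow> real poly \<Rightarrow> real" where
  "poly_levy_dist p q = levy_dist (root_measure p) (root_measure q)"

end

theory Submission
  imports Defs
begin

text \<open>
  Write a polynomial of degree at most \<open>d\<close> as \<open>b(D) x\<^sup>d\<close> with a power series \<open>b\<close> in the
  differentiation operator \<open>D\<close>. Finite free convolution then is multiplication of power series modulo
  \<open>X\<^bsup>d+1\<^esup>\<close> (\<open>finite_free_conv_appell_poly\<close>), dilation by \<open>c\<close> is \<open>X \<mapsto> c X\<close>, and the dilated Hermite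
  polynomial corresponds to \<open>exp (- X\<^sup>2 / (2 d))\<close>. The cumulant conditions say that \<open>p\<close> corresponds to
  \<open>b = 1 - X\<^sup>2 / (2 d) + \<dots>\<close>, with coefficients bounded in terms of \<open>d\<close> alone
  (\<open>standardized_appell_form\<close>). The claim thus becomes a central limit theorem for \<open>b(X / \<surd>n)\<^sup>n\<close> in a
  finite-dimensional Banach algebra, and replacing the factors by Gaussian ones one at a time gives
  the rate \<open>O(1 / \<surd>n)\<close> (\<open>fps_clt\<close>).

  This rate passes from coefficients to roots because the limit has \<open>d\<close> distinct real roots
  (\<open>card_roots_appell_poly_gauss\<close>): a polynomial near it changes sign near each of these roots, at a
  distance proportional to the perturbation (\<open>simple_root_perturbation\<close>). Matching each root with
  the nearby one bounds the Levy distance. For the finitely many \<open>n\<close> for which the perturbation is too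
  large, the Levy distance is at most 1, which a large constant absorbs.
\<close>

(* The dollar sign denotes power series coefficients throughout, never vector components. *)
unbundle no vec_syntax

section \<open>A central limit theorem for truncated power series\<close>

text \<open>Coefficients beyond degree \<open>d\<close> never reach a polynomial of degree \<open>d\<close>, so power series matter
  only modulo \<open>X\<^bsup>d+1\<^esup>\<close>. On this quotient the norm below is a Banach algebra norm with \<open>\<parallel>1\<parallel> = 1\<close>.\<close>

definition fps_trunc_norm :: "nat \<Rightarrow> real fps \<Rightarrow> real" where
  "fps_trunc_norm d f = (\<Sum>i\<le>d. \<bar>f $ i\<bar>)"

lemma fps_trunc_norm_nonneg [simp]: "0 \<le> fps_trunc_norm d f"
  by (simp add: fps_trunc_norm_def sum_nonneg)

lemma fps_trunc_norm_1 [simp]: "fps_trunc_norm d 1 = 1"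
proof -
  have "fps_trunc_norm d 1 = (\<Sum>i\<in>{0}. \<bar>(1 :: real fps) $ i\<bar>)"
    unfolding fps_trunc_norm_def by (rule sum.mono_neutral_right) auto
  then show ?thesis by simp
qed

lemma abs_nth_le_fps_trunc_norm: "i \<le> d \<Longrightarrow> \<bar>f $ i\<bar> \<le> fps_trunc_norm d f"
  unfolding fps_trunc_norm_def by (rule member_le_sum) auto

lemma fps_trunc_norm_triangle: "fps_trunc_norm d (f + g) \<le> fps_trunc_norm d f + fps_trunc_norm d g"
  unfolding fps_trunc_norm_def by (simp flip: sum.distrib add: sum_mono)

lemma fps_trunc_norm_mult: "fps_trunc_norm d (f * g) \<le> fps_trunc_norm d f * fps_trunc_norm d g"
proof -
  have "fps_trunc_norm d (f * g) \<le> (\<Sum>k\<le>d. \<Sum>i\<le>k. \<bar>f $ i\<bar> * \<bar>g $ (k - i)\<bar>)"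
    unfolding fps_trunc_norm_def fps_mult_nth atLeast0AtMost
    by (intro sum_mono order.trans[OF sum_abs]) (simp add: abs_mult)
  also have "\<dots> = (\<Sum>(i, j)\<in>{(i, j). i + j \<le> d}. \<bar>f $ i\<bar> * \<bar>g $ j\<bar>)"
    by (rule sum.triangle_reindex_eq[symmetric])
  also have "\<dots> \<le> (\<Sum>(i, j)\<in>{..d} \<times> {..d}. \<bar>f $ i\<bar> * \<bar>g $ j\<bar>)"
    by (rule sum_mono2) auto
  also have "\<dots> = fps_trunc_norm d f * fps_trunc_norm d g"
    by (simp add: fps_trunc_norm_def sum_product sum.cartesian_product)
  finally show ?thesis .
qed

lemma fps_trunc_norm_power: "fps_trunc_norm d f \<le> m \<Longrightarrow> fps_trunc_norm d (f ^ n) \<le> m ^ n"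
proof (induction n)
  case (Suc n)
  have "fps_trunc_norm d (f ^ Suc n) \<le> fps_trunc_norm d f * fps_trunc_norm d (f ^ n)"
    by (simp add: fps_trunc_norm_mult)
  also have "\<dots> \<le> m * m ^ n"
    using Suc by (intro mult_mono) (auto intro: order.trans[OF fps_trunc_norm_nonneg])
  finally show ?case by simp
qed simp

text \<open>Telescoping, as in Lindeberg's replacement method: the factors \<open>f\<close> are exchanged for \<open>g\<close> one at
  a time, and each exchange costs at most \<open>\<parallel>f - g\<parallel>\<close> times \<open>m\<close> to the number of the other factors.\<close>

lemma fps_trunc_norm_power_diff:
  assumes f: "fps_trunc_norm d f \<le> m" and g: "fps_trunc_norm d g \<le> m" and m: "1 \<le> m"
  shows "fps_trunc_norm d (f ^ n - g ^ n) \<le> n * m ^ n * fps_trunc_norm d (f - g)"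
proof (induction n)
  case 0
  show ?case by (simp add: fps_trunc_norm_def)
next
  case (Suc n)
  let ?\<delta> = "fps_trunc_norm d (f - g)"
  have "f ^ Suc n - g ^ Suc n = f * (f ^ n - g ^ n) + (f - g) * g ^ n"
    by (simp add: algebra_simps)
  then have "fps_trunc_norm d (f ^ Suc n - g ^ Suc n)
      \<le> fps_trunc_norm d f * fps_trunc_norm d (f ^ n - g ^ n) + ?\<delta> * fps_trunc_norm d (g ^ n)"
    by (simp only:) (intro order.trans[OF fps_trunc_norm_triangle] add_mono fps_trunc_norm_mult)
  also have "\<dots> \<le> m * (n * m ^ n * ?\<delta>) + ?\<delta> * m ^ Suc n"
  proof (intro add_mono mult_mono)
    have "fps_trunc_norm d (g ^ n) \<le> m ^ n" by (rule fps_trunc_norm_power[OF g])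
    also have "\<dots> \<le> m ^ Suc n" using m by (intro power_increasing) auto
    finally show "fps_trunc_norm d (g ^ n) \<le> m ^ Suc n" .
  qed (use m in \<open>auto intro: f Suc.IH simp del: of_nat_Suc\<close>)
  finally show ?case by (simp add: algebra_simps)
qed

text \<open>A central limit theorem for power series. Two series \<open>1 + c X\<^sup>2 + \<dots>\<close> with the same \<open>c\<close>, rescaled by
  \<open>X \<mapsto> X / \<surd>n\<close>, have norm \<open>1 + O(1/n)\<close>, so their \<open>n\<close>-th powers stay bounded; they differ only from
  the third coefficient on, hence by \<open>O(n\<^bsup>-3/2\<^esup>)\<close>, and telescoping multiplies this error by \<open>n\<close>.\<close>

lemma fps_clt:
  fixes f g :: "real fps"
  assumes f: "f $ 0 = 1" "f $ 1 = 0" and g: "g $ 0 = 1" "g $ 1 = 0" and fg: "f $ 2 = g $ 2"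
    and fM: "\<And>i. i \<le> d \<Longrightarrow> \<bar>f $ i\<bar> \<le> M" and gM: "\<And>i. i \<le> d \<Longrightarrow> \<bar>g $ i\<bar> \<le> M" and n: "n > 0"
  defines "D \<equiv> (\<lambda>h. h oo (fps_const (1 / sqrt (real n)) * fps_X))"
  shows "fps_trunc_norm d (D f ^ n - D g ^ n) \<le> 2 * real (d + 1) * M * exp (real (d + 1) * M) / sqrt n"
proof -
  let ?c = "1 / sqrt (real n)"
  have M0: "0 \<le> M" using fM[of 0] by simp
  have c: "0 \<le> ?c" "?c \<le> 1" "?c ^ 2 = 1 / n" using n by (auto simp: power_divide)
  have D_nth: "D h $ i = ?c ^ i * h $ i" for h i by (simp add: D_def)
  have small: "fps_trunc_norm d (D h) \<le> 1 + (d + 1) * M / n"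
    if h: "h $ 0 = 1" "h $ 1 = 0" and hM: "\<And>i. i \<le> d \<Longrightarrow> \<bar>h $ i\<bar> \<le> M" for h
  proof -
    have "\<bar>D h $ i\<bar> \<le> (if i = 0 then 1 else 0) + M / n" if i: "i \<le> d" for i
    proof -
      consider "i = 0" | "i = 1" | "2 \<le> i" by linarith
      then show ?thesis
      proof cases
        case 3
        have "\<bar>D h $ i\<bar> = ?c ^ i * \<bar>h $ i\<bar>" using c by (simp add: D_nth abs_mult)
        also have "\<dots> \<le> ?c ^ 2 * M"
          using c 3 hM[OF i] by (intro mult_mono power_decreasing) auto
        finally show ?thesis using 3 c by simp
      qed (use h M0 in \<open>auto simp: D_nth\<close>)
    qed
    then have "fps_trunc_norm d (D h) \<le> (\<Sum>i\<le>d. (if i = 0 then 1 else 0) + M / n)"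
      unfolding fps_trunc_norm_def by (intro sum_mono) auto
    also have "\<dots> = 1 + (d + 1) * M / n" by (simp add: sum.distrib algebra_simps)
    finally show ?thesis .
  qed
  have diff: "fps_trunc_norm d (D f - D g) \<le> (d + 1) * (?c ^ 3 * (2 * M))"
  proof -
    have "\<bar>(D f - D g) $ i\<bar> \<le> ?c ^ 3 * (2 * M)" if i: "i \<le> d" for i
    proof -
      consider "i = 0" | "i = 1" | "i = 2" | "3 \<le> i" by linarith
      then show ?thesis
      proof cases
        case 4
        have "\<bar>(D f - D g) $ i\<bar> = ?c ^ i * \<bar>f $ i - g $ i\<bar>"
          using c by (simp add: D_nth abs_mult flip: right_diff_distrib)
        also have "\<dots> \<le> ?c ^ 3 * (2 * M)"
          using c 4 fM[OF i] gM[OF i] by (intro mult_mono power_decreasing) auto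
        finally show ?thesis .
      qed (use f g fg M0 in \<open>auto simp: D_nth\<close>)
    qed
    then have "fps_trunc_norm d (D f - D g) \<le> (\<Sum>i\<le>d. ?c ^ 3 * (2 * M))"
      unfolding fps_trunc_norm_def by (intro sum_mono) auto
    then show ?thesis by (simp add: algebra_simps)
  qed
  let ?m = "1 + (d + 1) * M / n"
  have "fps_trunc_norm d (D f ^ n - D g ^ n) \<le> n * ?m ^ n * fps_trunc_norm d (D f - D g)"
    using M0 by (intro fps_trunc_norm_power_diff small f g fM gM) auto
  also have "\<dots> \<le> n * exp ((d + 1) * M) * ((d + 1) * (?c ^ 3 * (2 * M)))"
  proof (intro mult_mono diff)
    have "0 \<le> (d + 1) * M" using M0 by simp
    then have "- real n \<le> (d + 1) * M" by linarith
    then show "?m ^ n \<le> exp ((d + 1) * M)" using n by (rule exp_ge_one_plus_x_over_n_power_n)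
  qed (use M0 in auto)
  also have "?c ^ 3 = 1 / n * ?c" using c(3) by (simp add: power3_eq_cube power2_eq_square)
  also have "n * exp ((d + 1) * M) * ((d + 1) * (1 / n * ?c * (2 * M)))
      = 2 * real (d + 1) * M * exp (real (d + 1) * M) / sqrt n"
    using n by simp
  finally show ?thesis .
qed

section \<open>Convolution as multiplication of differential operators\<close>

text \<open>This is \<open>b(D) x\<^sup>d\<close>, where the power series \<open>b\<close> is evaluated at the differentiation operator
  \<open>D\<close>: the Appell polynomials of \<open>b\<close>. Every polynomial of degree at most \<open>d\<close> has this form.\<close>

definition appell_poly :: "nat \<Rightarrow> 'a::field_char_0 fps \<Rightarrow> 'a poly" where
  "appell_poly d b = (\<Sum>r\<le>d. monom (b $ r * (fact d / fact (d - r))) (d - r))"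

lemma sum_monom_rev: "(\<Sum>r\<le>d. monom (g r) (d - r)) = (\<Sum>k\<le>d. monom (g (d - k)) k)"
  by (rule sum.reindex_bij_witness[of _ "\<lambda>k. d - k" "\<lambda>k. d - k"]) auto

lemma coeff_sum_monom_rev:
  "coeff (\<Sum>r\<le>d. monom (g r) (d - r)) k = (if k \<le> d then g (d - k) else 0)"
  unfolding sum_monom_rev by (simp add: coeff_sum)

lemma coeff_appell_poly:
  "coeff (appell_poly d b) k = (if k \<le> d then b $ (d - k) * (fact d / fact k) else 0)"
  unfolding appell_poly_def by (simp add: coeff_sum_monom_rev)

lemma degree_appell_poly: "b $ 0 \<noteq> 0 \<Longrightarrow> degree (appell_poly d b) = d"
  by (intro antisym degree_le le_degree) (auto simp: coeff_appell_poly)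

lemma eq_appell_polyI:
  assumes "degree p \<le> d" and "\<And>i. i \<le> d \<Longrightarrow> b $ i = coeff p (d - i) * (fact (d - i) / fact d)"
  shows "p = appell_poly d b"
proof (rule poly_eqI)
  fix k show "coeff p k = coeff (appell_poly d b) k"
    using assms by (auto simp: coeff_appell_poly coeff_eq_0)
qed

text \<open>The reason for the factorials in the convolution: they turn it into composition of the
  operators \<open>b(D)\<close> and \<open>c(D)\<close>, that is, multiplication of the power series.\<close>

lemma finite_free_conv_appell_poly:
  "finite_free_conv d (appell_poly d b) (appell_poly d c) = appell_poly d (b * c)"
proof -
  have "(-1) ^ r * (\<Sum>(i, j)\<in>{(i, j). i + j = r}.
           fact (d - i) * fact (d - j) / (fact d * fact (d - i - j))
             * signed_coeff d (appell_poly d b) i * signed_coeff d (appell_poly d c) j)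
       = (b * c) $ r * (fact d / fact (d - r))" if r: "r \<le> d" for r
  proof -
    have "(-1) ^ r * (\<Sum>(i, j)\<in>{(i, j). i + j = r}.
           fact (d - i) * fact (d - j) / (fact d * fact (d - i - j))
             * signed_coeff d (appell_poly d b) i * signed_coeff d (appell_poly d c) j)
        = (\<Sum>i\<le>r. (-1) ^ r * (fact (d - i) * fact (d - (r - i)) / (fact d * fact (d - i - (r - i)))
             * signed_coeff d (appell_poly d b) i * signed_coeff d (appell_poly d c) (r - i)))"
      unfolding sum_distrib_left
      by (rule sum.reindex_bij_witness[of _ "\<lambda>i. (i, r - i)" fst]) auto
    also have "\<dots> = (\<Sum>i\<le>r. b $ i * c $ (r - i) * (fact d / fact (d - r)))"
    proof (rule sum.cong[OF refl])
      fix i assume "i \<in> {..r}"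
      then have i: "i \<le> r" by simp
      have sgn: "(-1) ^ r = (-1) ^ i * (-1 :: real) ^ (r - i)" using i by (simp flip: power_add)
      have sq: "(-1) ^ i * (-1) ^ i = (1 :: real)" for i :: nat by (simp flip: power_mult_distrib)
      have idx: "d - (d - i) = i" "d - (d - (r - i)) = r - i" "d - i - (r - i) = d - r"
        using i r by auto
      have "(-1) ^ r * (fact (d - i) * fact (d - (r - i)) / (fact d * fact (d - i - (r - i)))
             * signed_coeff d (appell_poly d b) i * signed_coeff d (appell_poly d c) (r - i))
          = ((-1) ^ i * (-1) ^ i) * ((-1) ^ (r - i) * (-1) ^ (r - i)) *
              (b $ i * c $ (r - i) * (fact d / fact (d - r)))"
        using i r by (simp add: sgn signed_coeff_def coeff_appell_poly idx field_simps)
      then show "(-1) ^ r * (fact (d - i) * fact (d - (r - i)) / (fact d * fact (d - i - (r - i)))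
             * signed_coeff d (appell_poly d b) i * signed_coeff d (appell_poly d c) (r - i))
          = b $ i * c $ (r - i) * (fact d / fact (d - r))"
        by (simp only: sq mult_1_left)
    qed
    also have "\<dots> = (b * c) $ r * (fact d / fact (d - r))"
      unfolding fps_mult_nth atLeast0AtMost by (rule sum_distrib_right[symmetric])
    finally show ?thesis .
  qed
  then show ?thesis
    unfolding finite_free_conv_def appell_poly_def[of d "b * c"] by (intro sum.cong) auto
qed

lemma finite_free_power_appell_poly:
  assumes "n > 0"
  shows "finite_free_power d (appell_poly d b) n = appell_poly d (b ^ n)"
proof -
  have "(finite_free_conv d (appell_poly d b) ^^ m) (appell_poly d b) = appell_poly d (b ^ Suc m)" for m
    by (induction m) (simp_all add: finite_free_conv_appell_poly)
  from this[of "n - 1"] show ?thesis using assms by (simp add: finite_free_power_def)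
qed

lemma dilation_appell_poly:
  assumes "c \<noteq> 0" and "b $ 0 \<noteq> 0"
  shows "dilation c (appell_poly d b) = appell_poly d (b oo (fps_const c * fps_X))"
proof (rule poly_eqI)
  fix k
  have "c ^ d * (1 / c) ^ k = c ^ (d - k)" if "k \<le> d"
    using assms(1) that by (simp add: power_diff power_divide)
  then show "coeff (dilation c (appell_poly d b)) k
      = coeff (appell_poly d (b oo (fps_const c * fps_X))) k"
    using assms(2)
    by (auto simp: dilation_def coeff_pcompose_linear coeff_appell_poly degree_appell_poly
          simp flip: mult.assoc)
qed

text \<open>Convergence of the series in the truncated norm becomes uniform convergence of the polynomials
  on bounded intervals.\<close>

lemma poly_appell_poly_diff_bound:
  fixes b c :: "real fps"
  assumes x: "\<bar>x\<bar> \<le> R" and R: "1 \<le> R"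
  shows "\<bar>poly (appell_poly d b) x - poly (appell_poly d c) x\<bar> \<le> fact d * R ^ d * fps_trunc_norm d (b - c)"
proof -
  have "poly (appell_poly d b) x - poly (appell_poly d c) x
      = (\<Sum>r\<le>d. (b - c) $ r * ((fact d / fact (d - r)) * x ^ (d - r)))"
    unfolding appell_poly_def
    by (simp add: poly_sum poly_monom algebra_simps flip: sum_subtractf diff_divide_distrib)
  also have "\<bar>\<dots>\<bar> \<le> (\<Sum>r\<le>d. \<bar>(b - c) $ r\<bar> * (fact d * R ^ d))"
  proof (rule order.trans[OF sum_abs sum_mono])
    fix r assume "r \<in> {..d}"
    have "\<bar>(fact d / fact (d - r)) * x ^ (d - r)\<bar> = (fact d / fact (d - r)) * \<bar>x\<bar> ^ (d - r)"
      by (simp add: abs_mult power_abs)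
    also have "\<dots> \<le> fact d * R ^ d"
    proof (rule mult_mono)
      have "fact d / fact (d - r) \<le> fact d / (1 :: real)"
        by (intro divide_left_mono) (auto simp: fact_ge_1)
      then show "fact d / fact (d - r) \<le> (fact d :: real)" by simp
      have "\<bar>x\<bar> ^ (d - r) \<le> R ^ (d - r)" by (rule power_mono[OF x]) simp
      also have "\<dots> \<le> R ^ d" using R by (intro power_increasing) auto
      finally show "\<bar>x\<bar> ^ (d - r) \<le> R ^ d" .
    qed auto
    finally show "\<bar>(b - c) $ r * ((fact d / fact (d - r)) * x ^ (d - r))\<bar>
        \<le> \<bar>(b - c) $ r\<bar> * (fact d * R ^ d)"
      unfolding abs_mult[of "(b - c) $ r"] by (rule mult_left_mono) simp
  qed
  also have "\<dots> = fact d * R ^ d * fps_trunc_norm d (b - c)"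
    unfolding fps_trunc_norm_def sum_distrib_right[symmetric] by simp
  finally show ?thesis .
qed

section \<open>The roots of Hermite polynomials\<close>

text \<open>Pincherle's commutation rule \<open>b(D) x = x b(D) + b'(D)\<close>, applied to \<open>x\<^sup>d\<close>.\<close>

lemma appell_poly_Suc:
  "appell_poly (Suc d) b = pCons 0 (appell_poly d b) + appell_poly d (fps_deriv b)"
proof (rule poly_eqI)
  fix k
  show "coeff (appell_poly (Suc d) b) k
      = coeff (pCons 0 (appell_poly d b) + appell_poly d (fps_deriv b)) k"
  proof (cases k)
    case 0
    then show ?thesis by (simp add: coeff_appell_poly algebra_simps)
  next
    case (Suc j)
    consider "j = d" | "j > d" | m where "d = Suc (j + m)"
      using less_imp_Suc_add by (metis linorder_neqE_nat)
    then show ?thesis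
    proof cases
      case 3
      have "of_nat (Suc d) = of_nat (Suc j) + (of_nat (Suc m) :: 'a)" by (simp add: 3)
      moreover have "(of_nat (Suc j) :: 'a) \<noteq> 0" by (rule of_nat_neq_0)
      ultimately show ?thesis
        by (simp add: Suc 3 coeff_appell_poly Suc_diff_le field_simps del: of_nat_Suc)
    qed (auto simp: Suc coeff_appell_poly of_nat_neq_0 simp del: of_nat_Suc)
  qed
qed

lemma pderiv_appell_poly:
  "pderiv (appell_poly (Suc d) b) = smult (of_nat (Suc d)) (appell_poly d b)"
proof (rule poly_eqI)
  fix k
  have "(of_nat (Suc k) :: 'a) \<noteq> 0" by (rule of_nat_neq_0)
  then show "coeff (pderiv (appell_poly (Suc d) b)) k
      = coeff (smult (of_nat (Suc d)) (appell_poly d b)) k"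
    by (simp add: coeff_pderiv coeff_appell_poly field_simps del: of_nat_Suc)
qed

text \<open>Multiplying the series by \<open>X\<close> applies one more \<open>D\<close>, and \<open>D x\<^bsup>d+1\<^esup> = (d + 1) x\<^sup>d\<close>.\<close>

lemma appell_poly_Suc_X_mult:
  "appell_poly (Suc d) (fps_X * b) = smult (of_nat (Suc d)) (appell_poly d b)"
proof (rule poly_eqI)
  fix k
  show "coeff (appell_poly (Suc d) (fps_X * b)) k = coeff (smult (of_nat (Suc d)) (appell_poly d b)) k"
    by (cases "k \<le> d") (auto simp: coeff_appell_poly Suc_diff_le)
qed

lemma appell_poly_const_mult: "appell_poly d (fps_const a * b) = smult a (appell_poly d b)"
  by (rule poly_eqI) (simp add: coeff_appell_poly)

text \<open>The series \<open>exp (c X\<^sup>2)\<close>. For \<open>c < 0\<close> its Appell polynomials are dilated Hermite polynomials. The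
  field is general because the roots of these polynomials are located within the complex numbers.\<close>

definition gauss_fps :: "'a::field_char_0 \<Rightarrow> 'a fps" where
  "gauss_fps c = fps_exp c oo fps_X ^ 2"

lemma gauss_fps_nth: "gauss_fps c $ i = (if even i then c ^ (i div 2) / fact (i div 2) else 0)"
  by (simp add: gauss_fps_def fps_nth_compose_X_power)

text \<open>Stability of the Gaussian: this is what makes the Hermite polynomial the limit.\<close>

lemma gauss_fps_scale_power:
  fixes c :: real
  assumes n: "n > 0"
  shows "(gauss_fps c oo (fps_const (1 / sqrt (real n)) * fps_X)) ^ n = gauss_fps c"
proof -
  have "gauss_fps c oo (fps_const (1 / sqrt (real n)) * fps_X) = gauss_fps (c / n)"
    by (rule fps_ext) (auto simp: gauss_fps_nth power_divide elim!: evenE simp: power_mult)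
  moreover have "gauss_fps (c / n) ^ n = gauss_fps c"
    using n by (simp add: gauss_fps_def fps_compose_power fps_exp_power_mult)
  ultimately show ?thesis by simp
qed

lemma fps_deriv_gauss_fps:
  "fps_deriv (gauss_fps c) = fps_const (2 * c) * (fps_X * gauss_fps c)"
proof -
  have "fps_deriv (gauss_fps c) = (fps_deriv (fps_exp c) oo fps_X ^ 2) * fps_deriv (fps_X ^ 2)"
    unfolding gauss_fps_def by (rule fps_compose_deriv) simp
  also have "fps_deriv (fps_exp c) oo fps_X ^ 2 = fps_const c * gauss_fps c"
    by (simp add: gauss_fps_def fps_compose_mult_distrib)
  also have "fps_deriv (fps_X ^ 2 :: 'a fps) = fps_const 2 * fps_X"
    by (simp add: fps_deriv_power numeral_fps_const)
  finally show ?thesis by (simp add: algebra_simps flip: fps_const_mult)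
qed

text \<open>The three-term recurrence of the Hermite polynomials, from \<open>b' = 2 c X b\<close> for \<open>b = exp (c X\<^sup>2)\<close>.\<close>

lemma appell_poly_gauss_recurrence:
  "appell_poly (Suc (Suc d)) (gauss_fps c)
     = pCons 0 (appell_poly (Suc d) (gauss_fps c))
       + smult (2 * c * of_nat (Suc d)) (appell_poly d (gauss_fps c))"
  unfolding appell_poly_Suc[of "Suc d"] fps_deriv_gauss_fps
  by (simp add: appell_poly_const_mult appell_poly_Suc_X_mult del: of_nat_Suc)

text \<open>For \<open>Im z > 0\<close> the ratio \<open>r\<^sub>d = P\<^bsub>d+1\<^esub>(z) / P\<^sub>d(z)\<close> stays in the upper half plane: by the recurrence
  \<open>r\<^bsub>d+1\<^esub> = z + k / r\<^sub>d\<close> with \<open>k < 0\<close>, and \<open>r \<mapsto> k / r\<close> maps that half plane to itself. The product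
  with \<open>Im z\<close> in the induction treats both half planes at once.\<close>

lemma appell_poly_gauss_no_nonreal_root:
  fixes c :: real and z :: complex
  assumes c: "c < 0" and z: "Im z \<noteq> 0"
  defines "P \<equiv> (\<lambda>d. poly (appell_poly d (gauss_fps (of_real c))) z)"
  shows "P d \<noteq> 0"
proof -
  have "P d \<noteq> 0 \<and> Im (P (Suc d) / P d) * Im z > 0"
  proof (induction d)
    case 0
    have "P 0 = 1" by (simp add: P_def appell_poly_def gauss_fps_nth)
    moreover have "P 1 = z" by (simp add: P_def appell_poly_def gauss_fps_nth poly_monom)
    moreover have "Im z * Im z > 0" using z by (auto simp: zero_less_mult_iff)
    ultimately show ?case by simp
  next
    case (Suc d)
    define r where "r = P (Suc d) / P d"
    from Suc have P: "P d \<noteq> 0" and r: "Im r * Im z > 0" by (auto simp: r_def)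
    have "Im r \<noteq> 0" using r by auto
    then have r0: "r \<noteq> 0" by auto
    then have P': "P (Suc d) \<noteq> 0" by (auto simp: r_def)
    define k where "k = 2 * c * real (Suc d)"
    have k: "k < 0" using c by (simp add: k_def mult_neg_pos)
    have rec: "P (Suc (Suc d)) = z * P (Suc d) + of_real k * P d"
      unfolding P_def appell_poly_gauss_recurrence k_def by simp
    have "P (Suc (Suc d)) / P (Suc d) = z + of_real k * inverse r"
      unfolding rec r_def using P P' by (simp add: field_simps)
    then have "Im (P (Suc (Suc d)) / P (Suc d)) = Im z + k * Im (inverse r)"
      by simp
    also have "Im (inverse r) = - Im r / (cmod r)\<^sup>2" by (simp add: cmod_power2)
    finally have "Im (P (Suc (Suc d)) / P (Suc d)) * Im z
        = Im z * Im z + (- k) * (Im r * Im z) / (cmod r)\<^sup>2"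
      by (simp only:) (simp add: algebra_simps)
    moreover have "Im z * Im z > 0" using z by (auto simp: zero_less_mult_iff)
    moreover have "(- k) * (Im r * Im z) / (cmod r)\<^sup>2 \<ge> 0"
      using k r by (intro divide_nonneg_nonneg mult_nonneg_nonneg[of "- k"]) auto
    ultimately show ?case using P' by linarith
  qed
  then show ?thesis by simp
qed

text \<open>Running the recurrence downwards, a common root of two consecutive polynomials would be a root of
  all of them, but the first is the constant 1.\<close>

lemma appell_poly_gauss_no_common_root:
  fixes z :: "'a::field_char_0"
  assumes "c \<noteq> 0" and "poly (appell_poly (Suc d) (gauss_fps c)) z = 0"
  shows "poly (appell_poly d (gauss_fps c)) z \<noteq> 0"
  using assms(2)
proof (induction d)
  case 0
  show ?case by (simp add: appell_poly_def gauss_fps_nth)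
next
  case (Suc d)
  show ?case
  proof
    assume 0: "poly (appell_poly (Suc d) (gauss_fps c)) z = 0"
    with Suc.prems have "poly (appell_poly d (gauss_fps c)) z = 0"
      unfolding appell_poly_gauss_recurrence using assms(1) by (simp del: of_nat_Suc)
    with Suc.IH[OF 0] show False by simp
  qed
qed

text \<open>The roots are real, and simple because the derivative of \<open>P\<^sub>d\<close> is \<open>d P\<^bsub>d-1\<^esub>\<close>, which has no root in
  common with \<open>P\<^sub>d\<close>. Over the complex numbers there are \<open>d\<close> roots with multiplicity.\<close>

lemma card_roots_appell_poly_gauss:
  assumes c: "c < (0::real)"
  shows "card {x. poly (appell_poly d (gauss_fps c)) x = 0} = d"
proof -
  let ?p = "appell_poly d (gauss_fps c)"
  let ?q = "appell_poly d (gauss_fps (complex_of_real c))"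
  have deg: "degree ?q = d" by (rule degree_appell_poly) (simp add: gauss_fps_nth)
  have "coeff ?q d \<noteq> 0" by (simp add: coeff_appell_poly gauss_fps_nth)
  then have q0: "?q \<noteq> 0" by auto
  have "order z ?q \<le> 1" for z
  proof (cases "poly ?q z = 0")
    case True
    then have "d \<noteq> 0" by (cases d) (auto simp: appell_poly_def gauss_fps_nth)
    then obtain e where e: "d = Suc e" by (cases d) auto
    have "poly (appell_poly e (gauss_fps (complex_of_real c))) z \<noteq> 0"
      using True c unfolding e by (intro appell_poly_gauss_no_common_root) auto
    then have "poly (pderiv ?q) z \<noteq> 0"
      unfolding e pderiv_appell_poly by (simp del: of_nat_Suc)
    then show ?thesis
      using q0 by (metis True order_pderiv order_root pderiv_eq_0_iff One_nat_def poly_0 le_refl deg e nat.distinct(1))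
  qed (simp add: order_0I)
  moreover have "order z ?q = 0 \<longleftrightarrow> poly ?q z \<noteq> 0" for z using q0 by (simp add: order_root)
  ultimately have "order z ?q = (if poly ?q z = 0 then 1 else 0)" for z
    by (metis One_nat_def le_Suc_eq le_zero_eq)
  then have "proots ?q = mset_set {z. poly ?q z = 0}"
    using q0 poly_roots_finite[OF q0] by (intro multiset_eqI) (simp add: count_mset_set')
  then have "card {z. poly ?q z = 0} = d"
    using size_proots_complex[of ?q] deg by simp
  moreover have "{z. poly ?q z = 0} = complex_of_real ` {x. poly ?p x = 0}"
  proof -
    have "gauss_fps (complex_of_real c) $ i = of_real (gauss_fps c $ i)" for i
      by (simp add: gauss_fps_nth)
    then have ev: "poly ?q (of_real x) = of_real (poly ?p x)" for x
      by (simp add: appell_poly_def poly_sum poly_monom)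
    have "z \<in> complex_of_real ` {x. poly ?p x = 0}" if "poly ?q z = 0" for z
    proof -
      have "Im z = 0" using that appell_poly_gauss_no_nonreal_root[OF c] by blast
      then have z: "z = of_real (Re z)" by (simp add: complex_eq_iff)
      then have "poly ?p (Re z) = 0" using that ev by (metis of_real_eq_0_iff)
      then show ?thesis using z by blast
    qed
    then show ?thesis using ev by auto
  qed
  ultimately show ?thesis by (simp add: card_image inj_on_def)
qed

lemma dilation_hermite_poly:
  assumes "d > 0"
  shows "dilation (1 / sqrt (real d)) (hermite_poly d) = appell_poly d (gauss_fps (- 1 / (2 * real d)))"
proof -
  have half: "2 ^ i * (- (1 / 2)) ^ i = (- 1 :: real) ^ i" for i
    by (simp flip: power_mult_distrib)
  have "hermite_poly d = appell_poly d (gauss_fps (- 1 / 2))"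
  proof -
    have "appell_poly d (gauss_fps (- 1 / 2)) =
      (\<Sum>r | r \<le> d \<and> even r. monom (gauss_fps (- 1 / 2) $ r * (fact d / fact (d - r))) (d - r) :: real poly)"
      unfolding appell_poly_def by (rule sum.mono_neutral_right) (auto simp: gauss_fps_nth)
    also have "\<dots> = (\<Sum>i\<le>d div 2. smult (fact d) (monom ((-1) ^ i / (fact i * fact (d - 2 * i)) * (1 / 2 ^ i)) (d - 2 * i)))"
      by (rule sum.reindex_bij_witness[of _ "\<lambda>i. 2 * i" "\<lambda>r. r div 2"])
         (auto simp: gauss_fps_nth smult_monom half field_simps power_divide elim!: evenE)
    finally show ?thesis by (simp add: hermite_poly_def poly_eq_iff coeff_sum sum_distrib_left)
  qed
  moreover have "gauss_fps (- 1 / 2) oo (fps_const (1 / sqrt (real d)) * fps_X) = gauss_fps (- 1 / (2 * real d))"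
  proof (rule fps_ext)
    fix i
    show "(gauss_fps (- 1 / 2) oo (fps_const (1 / sqrt (real d)) * fps_X)) $ i = gauss_fps (- 1 / (2 * real d)) $ i"
    proof (cases "even i")
      case True
      then obtain j where i: "i = 2 * j" by (elim evenE)
      have "(1 / sqrt (real d)) ^ (2 * j) * (- 1 / 2) ^ j = ((1 / sqrt (real d)) ^ 2 * (- 1 / 2)) ^ j"
        by (simp only: power_mult power_mult_distrib)
      also have "(1 / sqrt (real d)) ^ 2 * (- 1 / 2) = - 1 / (2 * real d)" by (simp add: power_divide)
      finally show ?thesis by (simp add: i gauss_fps_nth)
    qed (simp add: gauss_fps_nth)
  qed
  ultimately show ?thesis
    using assms by (simp add: dilation_appell_poly gauss_fps_nth)
qed

section \<open>Standardized real-rooted polynomials\<close>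

lemma of_real_prod_mset: "of_real (\<Prod>x\<in>#M. f x) = (\<Prod>x\<in>#M. of_real (f x))"
  by (induction M) auto

text \<open>Over the complex numbers the polynomial splits, and real-rootedness turns the factors into real
  ones. As real polynomials are determined by their values on the real line, the factorization is
  compared there.\<close>

lemma real_rooted_imp_prod_roots:
  assumes "real_rooted p" and "lead_coeff p = 1"
  shows "(\<Prod>x\<in>#proots p. [:- x, 1:]) = p" "size (proots p) = degree p"
proof -
  let ?q = "map_poly complex_of_real p"
  define M where "M = image_mset Re (proots ?q)"
  have lead: "lead_coeff ?q = 1"
    using assms(2) by (simp add: degree_map_poly coeff_map_poly)
  then have "?q \<noteq> 0" by auto
  have ev: "poly ?q (of_real x) = of_real (poly p x)" for x
    by (induction p) (auto simp: map_poly_pCons)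
  have re: "z = of_real (Re z)" if "z \<in># proots ?q" for z
  proof -
    have "poly ?q z = 0" using that \<open>?q \<noteq> 0\<close> by simp
    then show ?thesis using assms(1) unfolding real_rooted_def by (simp add: complex_is_Real_iff complex_eq_iff)
  qed
  have "poly (\<Prod>x\<in>#M. [:- x, 1:]) x = poly p x" for x
  proof -
    have "of_real (poly p x) = poly (\<Prod>z\<in>#proots ?q. [:- z, 1:]) (of_real x)"
      using complex_poly_decompose_multiset[of ?q] unfolding lead by (simp add: ev)
    also have "\<dots> = (\<Prod>z\<in>#proots ?q. of_real x - z)"
      by (simp add: poly_prod_mset image_mset.compositionality o_def)
    also have "\<dots> = (\<Prod>z\<in>#proots ?q. of_real (x - Re z))"
      by (intro arg_cong[of _ _ prod_mset] image_mset_cong) (use re in \<open>auto simp: complex_eq_iff\<close>)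
    also have "\<dots> = of_real (\<Prod>z\<in>#proots ?q. x - Re z)"
      by (simp add: of_real_prod_mset)
    also have "(\<Prod>z\<in>#proots ?q. x - Re z) = poly (\<Prod>x\<in>#M. [:- x, 1:]) x"
      by (simp add: M_def poly_prod_mset image_mset.compositionality o_def)
    finally show ?thesis by (simp only: of_real_eq_iff)
  qed
  then have p: "(\<Prod>x\<in>#M. [:- x, 1:]) = p"
    by (simp add: poly_eq_poly_eq_iff fun_eq_iff flip: poly_eq_poly_eq_iff)
  have "proots (\<Prod>x\<in>#M. [:- x, 1:]) = M"
  proof (induction M)
    case (add x M)
    have "(\<Prod>x\<in>#M. [:- x, 1:]) \<noteq> 0" by auto
    then have "proots ([:- x, 1:] * (\<Prod>x\<in>#M. [:- x, 1:])) = proots [:- x, 1:] + proots (\<Prod>x\<in>#M. [:- x, 1:])"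
      by (intro proots_mult) simp_all
    then show ?case using add by (simp del: mult_pCons_left)
  qed simp
  then have M: "proots p = M" unfolding p .
  show "(\<Prod>x\<in>#proots p. [:- x, 1:]) = p" using p unfolding M .
  show "size (proots p) = degree p"
    unfolding M by (simp add: M_def size_proots_complex degree_map_poly)
qed

text \<open>The reversed polynomial: its coefficients are the signed elementary symmetric functions of \<open>M\<close>.
  Newton's identity gives the second one, and submultiplicativity of the norm bounds all of them.\<close>

lemma prod_linear_fps:
  fixes M :: "real multiset" and d :: nat
  defines "f \<equiv> (\<Prod>x\<in>#M. 1 - fps_const x * fps_X)"
  shows "f $ 0 = 1" "f $ 1 = - (\<Sum>x\<in>#M. x)"
    "2 * f $ 2 = (\<Sum>x\<in>#M. x)\<^sup>2 - (\<Sum>x\<in>#M. x\<^sup>2)"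
    "(\<And>x. x \<in># M \<Longrightarrow> \<bar>x\<bar> \<le> L) \<Longrightarrow> fps_trunc_norm d f \<le> (1 + L) ^ size M"
proof -
  have "f $ 0 = 1 \<and> f $ 1 = - (\<Sum>x\<in>#M. x) \<and> 2 * f $ 2 = (\<Sum>x\<in>#M. x)\<^sup>2 - (\<Sum>x\<in>#M. x\<^sup>2)"
    unfolding f_def
  proof (induction M)
    case (add x M)
    then show ?case
      by (simp add: left_diff_distrib mult.assoc numeral_2_eq_2 power2_eq_square algebra_simps)
  qed auto
  then show "f $ 0 = 1" "f $ 1 = - (\<Sum>x\<in>#M. x)"
    "2 * f $ 2 = (\<Sum>x\<in>#M. x)\<^sup>2 - (\<Sum>x\<in>#M. x\<^sup>2)" by auto
  show "fps_trunc_norm d f \<le> (1 + L) ^ size M" if "\<And>x. x \<in># M \<Longrightarrow> \<bar>x\<bar> \<le> L"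
    unfolding f_def using that
  proof (induction M)
    case (add x M)
    let ?g = "\<Prod>x\<in>#M. 1 - fps_const x * fps_X"
    have L: "\<bar>x\<bar> \<le> L" "0 \<le> L" using add.prems[of x] by auto
    have "fps_trunc_norm d (1 - fps_const x * fps_X) \<le> fps_trunc_norm d 1 + fps_trunc_norm d (fps_const (- x) * fps_X)"
      using fps_trunc_norm_triangle[of d 1 "fps_const (- x) * fps_X"] by (simp flip: fps_const_neg)
    also have "fps_trunc_norm d (fps_const (- x) * fps_X) \<le> (\<Sum>i\<le>d. if i = 1 then \<bar>x\<bar> else 0)"
      unfolding fps_trunc_norm_def by (intro sum_mono) auto
    also have "\<dots> \<le> L" using L by simp
    finally have "fps_trunc_norm d (1 - fps_const x * fps_X) \<le> 1 + L" by simp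
    moreover have "fps_trunc_norm d ?g \<le> (1 + L) ^ size M" using add by simp
    ultimately have "fps_trunc_norm d (1 - fps_const x * fps_X) * fps_trunc_norm d ?g
        \<le> (1 + L) * (1 + L) ^ size M"
      using L by (intro mult_mono) auto
    then show ?case
      using fps_trunc_norm_mult[of d "1 - fps_const x * fps_X" ?g] by simp
  qed simp
qed

text \<open>The two cumulant conditions say that the roots have sum \<open>0\<close> and sum of squares \<open>d - 1\<close>. This fixes
  the series of \<open>p\<close> up to second order, with the same values as for \<open>exp (- X\<^sup>2 / (2 d))\<close>. It also bounds
  each root by \<open>d\<close>, which bounds the remaining coefficients uniformly in \<open>p\<close>.\<close>

lemma standardized_appell_form:
  assumes d: "2 \<le> d" and deg: "degree p = d" and lead: "lead_coeff p = 1" and rr: "real_rooted p"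
    and k1: "finite_free_cumulant1 p = 0" and k2: "finite_free_cumulant2 p = 1"
  obtains b where "p = appell_poly d b" "b $ 0 = 1" "b $ 1 = 0" "b $ 2 = - 1 / (2 * real d)"
    "\<And>i. i \<le> d \<Longrightarrow> \<bar>b $ i\<bar> \<le> (1 + d) ^ d"
proof -
  define M where "M = proots p"
  define f where "f = (\<Prod>x\<in>#M. 1 - fps_const x * fps_X)"
  have size: "size M = d" and p: "p = (\<Prod>x\<in>#M. [:- x, 1:])"
    using real_rooted_imp_prod_roots[OF rr lead] deg by (simp_all add: M_def)
  have reflect: "reflect_poly [:- x, 1:] = [:1, - x:]" for x :: real
    by (rule poly_eqI) (auto simp: coeff_reflect_poly coeff_pCons split: nat.splits)
  have "fps_of_poly (reflect_poly (\<Prod>x\<in>#M. [:- x, 1:])) = f"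
    unfolding f_def
    by (induction M)
       (auto simp: reflect_poly_mult fps_of_poly_mult reflect fps_of_poly_linear' simp del: mult_pCons_left)
  then have f: "f = fps_of_poly (reflect_poly p)" by (simp add: p)
  have f_nth: "f $ i = coeff p (d - i)" if "i \<le> d" for i
    using that deg by (simp add: f coeff_reflect_poly)
  have s1: "(\<Sum>x\<in>#M. x) = 0"
    using k1 d deg by (simp add: finite_free_cumulant1_def moment_def M_def)
  have s2: "(\<Sum>x\<in>#M. x\<^sup>2) = real d - 1"
  proof -
    have m1: "moment 1 p = 0" using k1 by (simp add: finite_free_cumulant1_def)
    have "real d / (real d - 1) * (1 / real d * (\<Sum>x\<in>#M. x\<^sup>2)) = 1"
      using k2 unfolding finite_free_cumulant2_def m1 by (simp add: deg moment_def M_def)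
    then have "(\<Sum>x\<in>#M. x\<^sup>2) / (real d - 1) = 1" using d by simp
    then show ?thesis using d by (simp add: divide_eq_1_iff)
  qed
  have root_bound: "\<bar>x\<bar> \<le> real d" if x: "x \<in># M" for x
  proof -
    obtain N where N: "M = add_mset x N" using x by (metis multi_member_split)
    have "0 \<le> (\<Sum>x\<in>#N. x\<^sup>2)" by (induction N) auto
    then have "x\<^sup>2 \<le> (\<Sum>x\<in>#M. x\<^sup>2)" by (simp add: N)
    also have "\<dots> \<le> (real d)\<^sup>2"
      unfolding s2 by (rule order.trans[of _ "real d"])
         (use d mult_left_mono[of 1 "real d" "real d"] in \<open>simp_all add: power2_eq_square\<close>)
    finally have "\<bar>x\<bar> \<le> \<bar>real d\<bar>" by (simp only: abs_le_square_iff)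
    then show ?thesis by simp
  qed
  define b where "b = Abs_fps (\<lambda>i. coeff p (d - i) * (fact (d - i) / fact d))"
  have b_nth: "b $ i = f $ i * (fact (d - i) / fact d)" if "i \<le> d" for i
    using that by (simp add: b_def f_nth)
  show thesis
  proof
    show "p = appell_poly d b" using deg by (intro eq_appell_polyI) (auto simp: b_def)
    show "b $ 0 = 1" using prod_linear_fps(1)[of M] by (simp add: b_nth flip: f_def)
    show "b $ 1 = 0" using prod_linear_fps(2)[of M] d s1 by (simp add: b_nth flip: f_def)
    obtain e where e: "d = Suc (Suc e)" using d by (metis add_2_eq_Suc le_Suc_ex)
    have "2 * f $ 2 = 1 - real d" using prod_linear_fps(3)[of M] s1 s2 by (simp flip: f_def)
    then have "f $ 2 = (1 - real d) / 2" by simp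
    moreover have "b $ 2 = f $ 2 * (fact (d - 2) / fact d)" using d by (rule b_nth)
    ultimately have "b $ 2 = (1 - real d) / 2 * (fact (d - 2) / fact d)" by (simp only:)
    also have "\<dots> = - 1 / (2 * real d)"
    proof -
      have cancel: "- y / 2 * (F / (y * (x * F))) = - 1 / (2 * x)" if "y \<noteq> 0" "F \<noteq> 0" for x y F :: real
        using that by simp
      have "fact d = (real d - 1) * (real d * fact (d - 2))" by (simp add: e)
      moreover have "1 - real d = - (real d - 1)" by simp
      moreover have "real d - 1 \<noteq> 0" using d by simp
      ultimately show ?thesis using cancel[of "real d - 1" "fact (d - 2)" "real d"] by (simp only: fact_nonzero)  simp
    qed
    finally show "b $ 2 = - 1 / (2 * real d)" .
    show "\<bar>b $ i\<bar> \<le> (1 + d) ^ d" if i: "i \<le> d" for i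
    proof -
      have "\<bar>b $ i\<bar> = \<bar>f $ i\<bar> * (fact (d - i) / fact d)" using i by (simp add: b_nth abs_mult)
      also have "\<dots> \<le> \<bar>f $ i\<bar> * 1" by (intro mult_left_mono) (auto simp: fact_mono)
      also have "\<dots> \<le> fps_trunc_norm d f" using abs_nth_le_fps_trunc_norm[OF i] by simp
      also have "\<dots> \<le> (1 + d) ^ d"
        using prod_linear_fps(4)[of M "real d" d] root_bound size by (simp add: f_def)
      finally show ?thesis by simp
    qed
  qed
qed

section \<open>Perturbation of simple roots\<close>

text \<open>As many distinct roots as the degree leave no room for further roots or multiplicities.\<close>

lemma proots_eq_mset_set_roots:
  fixes p :: "'a::idom poly"
  assumes p: "p \<noteq> 0" and A: "A \<subseteq> {x. poly p x = 0}" and card: "degree p \<le> card A"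
  shows "proots p = mset_set A"
proof -
  have fin: "finite {x. poly p x = 0}" by (rule poly_roots_finite[OF p])
  have "card {x. poly p x = 0} \<le> degree p" by (rule card_poly_roots_bound[OF p])
  with A card have A_eq: "A = {x. poly p x = 0}" by (intro card_seteq fin) auto
  have "finite A" using A fin by (rule finite_subset)
  moreover have "count (mset_set A) x \<le> count (proots p) x" for x
  proof (cases "x \<in> A")
    case True
    then have "order x p > 0" using A p by (auto simp: order_gt_0_iff)
    then show ?thesis using p \<open>finite A\<close> by (simp add: count_mset_set')
  qed simp
  then have "mset_set A \<subseteq># proots p" by (rule mset_subset_eqI)
  moreover have "size (proots p) \<le> size (mset_set A)"
    using size_proots_le[of p] card \<open>finite A\<close> by simp
  ultimately show ?thesis
    by (metis leD mset_subset_size subset_mset.le_imp_less_or_eq)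
qed

lemma poly_eq_prod_simple_roots:
  fixes p :: "real poly"
  assumes "lead_coeff p = 1" "finite A" "A \<subseteq> {x. poly p x = 0}" "degree p = card A"
  shows "p = (\<Prod>a\<in>A. [:- a, 1:])"
proof (rule poly_eqI_degree_lead_coeff[of _ "card A" _ A])
  show "degree (\<Prod>a\<in>A. [:- a, 1:]) \<le> card A" by (simp add: degree_prod_sum_eq)
  show "coeff p (card A) = coeff (\<Prod>a\<in>A. [:- a, 1:]) (card A)"
    using assms lead_coeff_prod[of "\<lambda>a. [:- a, 1:]" A] by (simp add: degree_prod_sum_eq)
qed (use assms in \<open>auto simp: poly_prod\<close>)

text \<open>Let \<open>3 s\<close> be at most the smallest gap between the roots \<open>A\<close> of \<open>p\<close>. At \<open>a - t\<close> and \<open>a + t\<close> with \<open>t \<le> s\<close> the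
  polynomial \<open>p\<close> has opposite signs and absolute value at least \<open>t s\<^bsup>|A|-1\<^esup>\<close>. A polynomial \<open>q\<close> that is
  closer to \<open>p\<close> than this changes sign as well and has a root within \<open>t\<close> of each \<open>a\<close>. By its degree these
  are all roots of \<open>q\<close>; in particular \<open>q\<close> is real-rooted. The error \<open>t\<close> is linear in the distance
  of \<open>q\<close> from \<open>p\<close> because the roots of \<open>p\<close> are simple.\<close>

lemma simple_root_perturbation:
  fixes p :: "real poly"
  assumes A: "A \<subseteq> {x. poly p x = 0}" and lead: "lead_coeff p = 1" and deg: "degree p = card A" and fin: "finite A"
  obtains s \<gamma> R :: real where "0 < s" "0 < \<gamma>" "1 \<le> R"
    "\<forall>t q. 0 < t \<and> t \<le> s \<and> degree q = card A \<and> q \<noteq> 0 \<and>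
        (\<forall>x. \<bar>x\<bar> \<le> R \<longrightarrow> \<bar>poly q x - poly p x\<bar> < \<gamma> * t)
      \<longrightarrow> (\<exists>f. inj_on f A \<and> proots q = mset_set (f ` A) \<and> (\<forall>a\<in>A. \<bar>f a - a\<bar> \<le> t))"
proof -
  have p: "poly p x = (\<Prod>a\<in>A. x - a)" for x
    by (subst poly_eq_prod_simple_roots[OF lead fin A deg]) (simp add: poly_prod)
  have "uniform_discrete A" using fin uniform_discrete_finite_iff by blast
  then obtain e where e: "0 < e" "\<And>a b. \<lbrakk>a \<in> A; b \<in> A; a \<noteq> b\<rbrakk> \<Longrightarrow> e \<le> \<bar>a - b\<bar>"
    unfolding uniform_discrete_def dist_real_def by (metis not_less)
  define s where "s = e / 3"
  have s: "0 < s" "\<And>a b. \<lbrakk>a \<in> A; b \<in> A; a \<noteq> b\<rbrakk> \<Longrightarrow> 3 * s \<le> \<bar>a - b\<bar>"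
    using e by (auto simp: s_def)
  obtain R0 where R0: "\<And>a. a \<in> A \<Longrightarrow> \<bar>a\<bar> \<le> R0"
    using finite_imp_bounded[OF fin] by (auto simp: bounded_real)
  define R where "R = max 1 (R0 + s)"
  show thesis
  proof (rule that[of s "s ^ (card A - 1)" R])
    show "0 < s" "0 < s ^ (card A - 1)" "1 \<le> R" using s by (auto simp: R_def)
  next
    show "\<forall>t q. 0 < t \<and> t \<le> s \<and> degree q = card A \<and> q \<noteq> 0 \<and>
        (\<forall>x. \<bar>x\<bar> \<le> R \<longrightarrow> \<bar>poly q x - poly p x\<bar> < s ^ (card A - 1) * t)
      \<longrightarrow> (\<exists>f. inj_on f A \<and> proots q = mset_set (f ` A) \<and> (\<forall>a\<in>A. \<bar>f a - a\<bar> \<le> t))"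
    proof (intro allI impI, elim conjE)
    fix t and q :: "real poly"
    assume t: "0 < t" "t \<le> s" and q: "degree q = card A" "q \<noteq> 0"
      and close': "\<forall>x. \<bar>x\<bar> \<le> R \<longrightarrow> \<bar>poly q x - poly p x\<bar> < s ^ (card A - 1) * t"
    then have close: "\<bar>x\<bar> \<le> R \<Longrightarrow> \<bar>poly q x - poly p x\<bar> < s ^ (card A - 1) * t" for x by blast
    have root: "\<exists>y. a - t \<le> y \<and> y \<le> a + t \<and> poly q y = 0" if a: "a \<in> A" for a
    proof -
      let ?B = "A - {a}"
      have split: "poly p x = (x - a) * (\<Prod>b\<in>?B. x - b)" for x
        unfolding p by (rule prod.remove[OF fin a])
      have big: "s ^ (card A - 1) * t \<le> \<bar>poly p x\<bar>" if x: "\<bar>x - a\<bar> = t" for x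
      proof -
        have "s ^ (card A - 1) = (\<Prod>b\<in>?B. s)" using a fin by simp
        also have "\<dots> \<le> (\<Prod>b\<in>?B. \<bar>x - b\<bar>)"
        proof (rule prod_mono)
          fix b assume "b \<in> ?B"
          then have "3 * s \<le> \<bar>a - b\<bar>" using s(2)[OF a] by auto
          then show "0 \<le> s \<and> s \<le> \<bar>x - b\<bar>" using x t s(1) by linarith
        qed
        finally have "s ^ (card A - 1) * t \<le> (\<Prod>b\<in>?B. \<bar>x - b\<bar>) * t"
          using t by (intro mult_right_mono) auto
        then show ?thesis unfolding split abs_mult x abs_prod by (simp add: mult.commute)
      qed
      have neg: "poly p (a - t) * poly p (a + t) < 0"
      proof -
        have "0 < (\<Prod>b\<in>?B. (a - t - b) * (a + t - b))"
        proof (rule prod_pos)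
          fix b assume "b \<in> ?B"
          then have "3 * s \<le> \<bar>a - b\<bar>" using s(2)[OF a] by auto
          then have "t\<^sup>2 < \<bar>a - b\<bar>\<^sup>2" using t s(1) by (intro power_strict_mono) auto
          then show "0 < (a - t - b) * (a + t - b)" by (simp add: algebra_simps power2_eq_square)
        qed
        then have "0 < (\<Prod>b\<in>?B. a - t - b) * (\<Prod>b\<in>?B. a + t - b)" by (simp add: prod.distrib)
        moreover have "poly p (a - t) * poly p (a + t) = - (t * t) * ((\<Prod>b\<in>?B. a - t - b) * (\<Prod>b\<in>?B. a + t - b))"
          unfolding split by simp
        ultimately show ?thesis using t by (simp add: mult_neg_pos)
      qed
      have R: "\<bar>a - t\<bar> \<le> R" "\<bar>a + t\<bar> \<le> R" using R0[OF a] t by (auto simp: R_def)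
      have c1: "\<bar>poly q (a - t) - poly p (a - t)\<bar> < \<bar>poly p (a - t)\<bar>"
        using close[OF R(1)] big[of "a - t"] t by simp
      have c2: "\<bar>poly q (a + t) - poly p (a + t)\<bar> < \<bar>poly p (a + t)\<bar>"
        using close[OF R(2)] big[of "a + t"] t by simp
      have cont: "\<forall>x. a - t \<le> x \<and> x \<le> a + t \<longrightarrow> isCont (poly q) x" by simp
      from neg consider "poly p (a - t) < 0" "0 < poly p (a + t)" | "0 < poly p (a - t)" "poly p (a + t) < 0"
        by (auto simp: mult_less_0_iff)
      then show ?thesis
      proof cases
        case 1
        then have "poly q (a - t) \<le> 0" "0 \<le> poly q (a + t)" using c1 c2 by linarith+
        then show ?thesis using IVT[of "poly q" "a - t" 0 "a + t"] t cont by simp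
      next
        case 2
        then have "poly q (a + t) \<le> 0" "0 \<le> poly q (a - t)" using c1 c2 by linarith+
        then show ?thesis using IVT2[of "poly q" "a + t" 0 "a - t"] t cont by simp
      qed
    qed
    then obtain f where f: "\<And>a. a \<in> A \<Longrightarrow> a - t \<le> f a \<and> f a \<le> a + t \<and> poly q (f a) = 0"
      by metis
    have near: "\<bar>f a - a\<bar> \<le> t" if "a \<in> A" for a using f[OF that] by linarith
    have inj: "inj_on f A"
    proof (rule inj_onI, rule ccontr)
      fix a b assume ab: "a \<in> A" "b \<in> A" "f a = f b" "a \<noteq> b"
      then show False using s(2)[of a b] near[of a] near[of b] t s(1) by linarith
    qed
    have "proots q = mset_set (f ` A)"
      using q f inj by (intro proots_eq_mset_set_roots) (auto simp: card_image)
    then show "\<exists>f. inj_on f A \<and> proots q = mset_set (f ` A) \<and> (\<forall>a\<in>A. \<bar>f a - a\<bar> \<le> t)"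
      using inj near by blast
    qed
  qed
qed

section \<open>Levy distance of root measures\<close>

lemma levy_distI:
  assumes "0 < t" "\<And>x. cdf M (x - t) - t \<le> cdf N x" "\<And>x. cdf N x \<le> cdf M (x + t) + t"
  shows "levy_dist M N \<le> t"
  unfolding levy_dist_def by (rule cInf_lower) (use assms in \<open>auto intro: bdd_belowI[of _ 0]\<close>)

text \<open>For \<open>\<epsilon> = 1\<close> the defining inequalities hold for any two probability measures. A
  \<open>root_measure\<close> is one even if the polynomial has no real root at all, since the underlying
  \<open>pmf\<close> type contains only probability distributions.\<close>

lemma poly_levy_dist_le_1: "poly_levy_dist p q \<le> 1"
proof -
  have "prob_space (root_measure p)" for p
    unfolding root_measure_def by (rule measure_pmf.prob_space_distr) simp
  then have cdf: "0 \<le> cdf (root_measure p) x" "cdf (root_measure p) x \<le> 1" for p x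
    by (simp_all add: cdf_def prob_space.prob_le_1)
  show ?thesis
    unfolding poly_levy_dist_def
  proof (rule levy_distI)
    fix x
    show "cdf (root_measure p) (x - 1) - 1 \<le> cdf (root_measure q) x"
      using cdf(2)[of p "x - 1"] cdf(1)[of q x] by linarith
    show "cdf (root_measure q) x \<le> cdf (root_measure p) (x + 1) + 1"
      using cdf(2)[of q x] cdf(1)[of p "x + 1"] by linarith
  qed simp
qed

text \<open>The root measure as the law of \<open>f\<close> under the uniform distribution on \<open>A\<close>. Using the same \<open>A\<close> for two
  polynomials couples their root measures.\<close>

lemma cdf_root_measure:
  assumes A: "finite A" "A \<noteq> {}" and f: "inj_on f A" "proots p = mset_set (f ` A)"
  shows "cdf (root_measure p) x = measure_pmf.prob (pmf_of_set A) {a. f a \<le> x}"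
proof -
  have "pmf_of_multiset (proots p) = map_pmf f (pmf_of_set A)"
    using A f by (simp add: map_pmf_of_set image_mset_mset_set)
  then show ?thesis
    by (simp add: cdf_def root_measure_def measure_distr vimage_def)
qed

lemma poly_levy_dist_close_roots:
  assumes A: "finite A" "A \<noteq> {}" and f: "inj_on f A" "proots p = mset_set (f ` A)"
    and q: "proots q = mset_set A" and t: "0 < t" and close: "\<And>a. a \<in> A \<Longrightarrow> \<bar>f a - a\<bar> \<le> t"
  shows "poly_levy_dist p q \<le> t"
proof -
  let ?P = "measure_pmf.prob (pmf_of_set A)"
  have P: "cdf (root_measure p) x = ?P {a. f a \<le> x}" for x by (rule cdf_root_measure[OF A f])
  have Q: "cdf (root_measure q) x = ?P {a. a \<le> x}" for x
    using cdf_root_measure[OF A, of "\<lambda>a. a" q] q by simp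
  have mono: "?P X \<le> ?P Y" if "\<And>a. \<lbrakk>a \<in> A; a \<in> X\<rbrakk> \<Longrightarrow> a \<in> Y" for X Y
    by (rule measure_pmf.finite_measure_mono_AE) (use that A in \<open>auto simp: AE_measure_pmf_iff\<close>)
  show ?thesis
    unfolding poly_levy_dist_def
  proof (rule levy_distI[OF t])
    fix x
    have "?P {a. f a \<le> x - t} \<le> ?P {a. a \<le> x}" by (rule mono) (use close in fastforce)
    then show "cdf (root_measure p) (x - t) - t \<le> cdf (root_measure q) x" using t by (simp add: P Q)
    have "?P {a. a \<le> x} \<le> ?P {a. f a \<le> x + t}" by (rule mono) (use close in fastforce)
    then show "cdf (root_measure q) x \<le> cdf (root_measure p) (x + t) + t" using t by (simp add: P Q)
  qed
qed

section \<open>The rate of convergence\<close>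

theorem theorem1p1:
  fixes d :: nat
  assumes "d \<ge> 2"
  shows "\<exists>C::real. C > 0 \<and>
    (\<forall>p::real poly. \<forall>n::nat.
       degree p = d \<longrightarrow> lead_coeff p = 1 \<longrightarrow> real_rooted p \<longrightarrow>
       finite_free_cumulant1 p = 0 \<longrightarrow> finite_free_cumulant2 p = 1 \<longrightarrow> n > 0 \<longrightarrow>
       poly_levy_dist (dilation (1 / sqrt (real n)) (finite_free_power d p n))
                      (dilation (1 / sqrt (real d)) (hermite_poly d))
         < C / sqrt (real n))"
proof -
  define g where "g = gauss_fps (- 1 / (2 * real d))"
  define H where "H = appell_poly d g"
  define A where "A = {x. poly H x = 0}"
  have H: "dilation (1 / sqrt (real d)) (hermite_poly d) = H"
    using assms by (simp add: H_def g_def dilation_hermite_poly)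
  have cardA: "card A = d"
    unfolding A_def H_def g_def using assms by (intro card_roots_appell_poly_gauss) simp
  then have A: "finite A" "A \<noteq> {}" using assms by (auto intro: card_ge_0_finite)
  have g: "g $ 0 = 1" "g $ 1 = 0" "g $ 2 = - 1 / (2 * real d)" by (simp_all add: g_def gauss_fps_nth)
  have degH: "degree H = d" using g by (simp add: H_def degree_appell_poly)
  have leadH: "lead_coeff H = 1" unfolding degH using g by (simp add: H_def coeff_appell_poly)
  then have "H \<noteq> 0" by auto
  have rootsH: "proots H = mset_set A"
    using \<open>H \<noteq> 0\<close> degH cardA by (intro proots_eq_mset_set_roots) (auto simp: A_def)
  have subA: "A \<subseteq> {x. poly H x = 0}" and degH': "degree H = card A"
    by (simp_all add: A_def degH flip: cardA)
  obtain s \<gamma> R :: real where s: "0 < s" "0 < \<gamma>" "1 \<le> R" and pert: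
    "\<forall>t q. 0 < t \<and> t \<le> s \<and> degree q = card A \<and> q \<noteq> 0 \<and>
        (\<forall>x. \<bar>x\<bar> \<le> R \<longrightarrow> \<bar>poly q x - poly H x\<bar> < \<gamma> * t)
      \<longrightarrow> (\<exists>f. inj_on f A \<and> proots q = mset_set (f ` A) \<and> (\<forall>a\<in>A. \<bar>f a - a\<bar> \<le> t))"
    by (rule simple_root_perturbation[OF subA leadH degH' A(1)])
  define M where "M = real ((1 + d) ^ d)"
  have gM: "\<bar>g $ i\<bar> \<le> M" for i
  proof -
    have "\<bar>g $ i\<bar> \<le> 1"
    proof (cases "even i")
      case True
      have "\<bar>g $ i\<bar> = (1 / (2 * real d)) ^ (i div 2) / fact (i div 2)"
        using True by (simp add: g_def gauss_fps_nth power_abs)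
      also have "\<dots> \<le> 1 / 1"
        using assms by (intro frac_le power_le_one) (auto simp: fact_ge_1)
      finally show ?thesis by simp
    qed (simp add: g_def gauss_fps_nth)
    moreover have "1 \<le> M" by (simp add: M_def flip: of_nat_power)
    ultimately show ?thesis by simp
  qed
  define K where "K = fact d * R ^ d * (2 * real (d + 1) * M * exp (real (d + 1) * M))"
  have "0 < M" by (simp add: M_def flip: of_nat_power)
  then have "0 < K" using s by (simp add: K_def)
  \<comment> \<open>The factor 2 gives the strict inequality that the root perturbation asks for.\<close>
  define T where "T = 2 * K / \<gamma>"
  have T: "0 < T" "K < \<gamma> * T" using \<open>0 < K\<close> s by (auto simp: T_def)
  \<comment> \<open>If \<open>T / \<surd>n \<le> s\<close>, the roots move by at most \<open>T / \<surd>n\<close>; otherwise \<open>T / s > \<surd>n\<close>, and the trivial bound 1 is enough.\<close>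
  define C where "C = T + T / s + 1"
  have C: "T < C" "T / s < C" "0 < C" using T s by (auto simp: C_def add_pos_pos)
  have "poly_levy_dist (dilation (1 / sqrt (real n)) (finite_free_power d p n)) H < C / sqrt (real n)"
    if p: "degree p = d" "lead_coeff p = 1" "real_rooted p"
      "finite_free_cumulant1 p = 0" "finite_free_cumulant2 p = 1" and n: "n > 0" for p n
  proof (cases "T / sqrt n \<le> s")
    case True
    obtain b where b: "p = appell_poly d b" "b $ 0 = 1" "b $ 1 = 0" "b $ 2 = - 1 / (2 * real d)"
        "\<And>i. i \<le> d \<Longrightarrow> \<bar>b $ i\<bar> \<le> M"
      unfolding M_def by (rule standardized_appell_form[OF assms p]) auto
    let ?D = "\<lambda>h. h oo (fps_const (1 / sqrt (real n)) * fps_X)"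
    define q where "q = dilation (1 / sqrt (real n)) (finite_free_power d p n)"
    have q: "q = appell_poly d (?D b ^ n)"
      using n b(2) by (simp add: q_def b(1) finite_free_power_appell_poly dilation_appell_poly fps_compose_power)
    have b0: "(?D b ^ n) $ 0 = 1" using b(2) by (simp add: fps_power_zeroth)
    have deg: "degree q = card A" unfolding q cardA using b0 by (simp add: degree_appell_poly)
    then have "q \<noteq> 0" using cardA assms by auto
    have "\<bar>poly q x - poly H x\<bar> < \<gamma> * (T / sqrt n)" if x: "\<bar>x\<bar> \<le> R" for x
    proof -
      have "\<bar>poly q x - poly H x\<bar> \<le> fact d * R ^ d * fps_trunc_norm d (?D b ^ n - g)"
        unfolding q H_def by (rule poly_appell_poly_diff_bound[OF x s(3)])
      also have "g = ?D g ^ n" unfolding g_def using n by (rule gauss_fps_scale_power[symmetric])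
      also have "fps_trunc_norm d (?D b ^ n - ?D g ^ n) \<le> 2 * real (d + 1) * M * exp (real (d + 1) * M) / sqrt n"
        using b g gM n by (intro fps_clt) auto
      finally have "\<bar>poly q x - poly H x\<bar> \<le> K / sqrt n"
        using s by (simp add: K_def mult_left_mono)
      also have "\<dots> < \<gamma> * (T / sqrt n)" using T n by (simp add: divide_strict_right_mono)
      finally show ?thesis .
    qed
    then obtain f where f: "inj_on f A" "proots q = mset_set (f ` A)" "\<forall>a\<in>A. \<bar>f a - a\<bar> \<le> T / sqrt n"
      using pert[rule_format, of "T / sqrt n" q] True T n deg \<open>q \<noteq> 0\<close> by auto
    have "poly_levy_dist q H \<le> T / sqrt n"
      using f T n by (intro poly_levy_dist_close_roots[OF A f(1,2) rootsH]) auto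
    also have "\<dots> < C / sqrt n" using C n by (simp add: divide_strict_right_mono)
    finally show ?thesis by (simp add: q_def)
  next
    case False
    then have "sqrt n < T / s" using s n by (simp add: field_simps)
    then have "1 < C / sqrt n" using C n by simp
    then show ?thesis using poly_levy_dist_le_1 order.strict_trans1 by blast
  qed
  then show ?thesis unfolding H using C(3) by blast
qed

end
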